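(* Let $0<r_0<R\le+\infty$, and let $\varphi:(r_0,R)\to[0,\infty)$ be a function with $$\limsup_{r\to R^-}\varphi(r)=K\quad\text{and}\quad\liminf_{r\to R^-}\varphi(r)=k,$$ where $0\le k<K<\infty$. If there exists a $\psi\in\mathcal{D}(r_0,R)$ such that $\varphi(r)\psi(r)$ is non-decreasing on $(r_0,R)$, then for any $\varepsilon>0$ the sets $$F_\varepsilon=\{r\in(r_0,R):|\varphi(r)-K|<\varepsilon\}\quad\text{and}\quad G_\varepsilon=\{r\in(r_0,R):|\varphi(r)-k|<\varepsilon\}$$ satisfy $$\overline{\psi\text{-dens}}(F_\varepsilon)\ge\frac{\varepsilon}{K},\qquad \overline{\psi\text{-dens}}(G_\varepsilon)\ge\frac{\varepsilon}{k+\varepsilon},$$ $$\underline{\psi\text{-dens}}(F_\varepsilon)\le\frac{k}{k+\varepsilon},\qquad \underline{\psi\text{-dens}}(G_\varepsilon)\le\frac{K-\varepsilon}{K}.$$ In addition, $$\overline{e^{\psi}\text{-dens}}(F_\varepsilon)=\overline{e^{\psi}\text{-dens}}(G_\varepsilon)=1,\qquad \underline{e^{\psi}\text{-dens}}(F_\varepsilon)=\underline{e^{\psi}\text{-dens}}(G_\varepsilon)=0.$$ If (instead of $K<\infty$) $K=+\infty$, then for every large $M>0$ the set $H_M=\{r\in(r_0,R):\varphi(r)>M\}$ satisfies $$\overline{\psi\text{-dens}}(H_M)=1\quad\text{and}\quad\underline{\psi\text{-dens}}(H_M)\le\frac{k}{M}.$$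
   Context: For $0<r_0<R\le\infty$, $\mathcal{D}(r_0,R)$ denotes the class of positive, unbounded, differentiable and strictly increasing functions on $(r_0,R)$. For $\psi\in\mathcal{D}(r_0,R)$ and a set $E\subset(r_0,R)$, the upper and lower $\psi$-densities of $E$ are $$\overline{\psi\text{-dens}}(E)=\limsup_{r\to R^-}\frac{1}{\psi(r)}\int_{E\cap[r_0,r)}\psi'(t)\,dt,\qquad \underline{\psi\text{-dens}}(E)=\liminf_{r\to R^-}\frac{1}{\psi(r)}\int_{E\cap[r_0,r)}\psi'(t)\,dt .$$ The $e^\psi$-densities are defined in the same way with $e^{\psi}$ in place of $\psi$.
   Formalization: "For any ε>0" fails for large ε, so some claims are restricted: upper ψ-dens(F) to ε≤K; lower ψ-dens(F) to 2ε≤K−k, or k=0 and ε<K; lower ψ-dens(G) to 2ε≤K−k; lower e^ψ-densities to ε<K−k. The other claims hold for all ε>0. *)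

theory Defs
  imports "HOL-Analysis.Analysis"
begin

text \<open>The filter \<open>r \<rightarrow> R\<^sup>-\<close> on the reals, where \<open>R \<le> \<infinity>\<close> is an extended real.\<close>

definition left_end :: "ereal \<Rightarrow> real filter" where
  "left_end R = filtercomap ereal (at_left R)"

lemma filtercomap_filtermap_ereal: "filtercomap ereal (filtermap ereal F) = F"
proof (rule filter_eqI)
  fix P :: "real \<Rightarrow> bool"
  show "eventually P (filtercomap ereal (filtermap ereal F)) = eventually P F"
  proof
    assume "eventually P (filtercomap ereal (filtermap ereal F))"
    then show "eventually P F"
      by (auto simp: eventually_filtercomap eventually_filtermap elim: eventually_mono)
  next
    assume "eventually P F"
    then show "eventually P (filtercomap ereal (filtermap ereal F))"
      unfolding eventually_filtercomap eventually_filtermap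
      by (intro exI[of _ "\<lambda>x. P (real_of_ereal x)"]) simp
  qed
qed

lemma left_end_real: "left_end (ereal R) = at_left R"
  by (simp add: left_end_def at_left_ereal filtercomap_filtermap_ereal)

lemma left_end_infinity: "left_end \<infinity> = at_top"
  by (simp add: left_end_def at_left_PInf filtercomap_filtermap_ereal)

definition class_D :: "real \<Rightarrow> ereal \<Rightarrow> (real \<Rightarrow> real) set" where
  "class_D r0 R = {\<psi>.
     (\<forall>r\<in>einterval (ereal r0) R. 0 < \<psi> r) \<and>
     \<not> bounded (\<psi> ` einterval (ereal r0) R) \<and>
     \<psi> differentiable_on einterval (ereal r0) R \<and>
     strict_mono_on (einterval (ereal r0) R) \<psi>}"

text \<open>Meaningful for measurable subsets \<open>E\<close> of the interval \<open>(r0, R)\<close>, where the integral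
  is the Lebesgue integral of the nonnegative function \<open>\<psi>'\<close>.\<close>

definition dens_quotient :: "real \<Rightarrow> (real \<Rightarrow> real) \<Rightarrow> real set \<Rightarrow> real \<Rightarrow> real" where
  "dens_quotient r0 \<psi> E r = 1 / \<psi> r * (LINT t:E \<inter> {r0..<r}|lebesgue. deriv \<psi> t)"

definition upper_dens :: "real \<Rightarrow> ereal \<Rightarrow> (real \<Rightarrow> real) \<Rightarrow> real set \<Rightarrow> ereal" where
  "upper_dens r0 R \<psi> E = Limsup (left_end R) (\<lambda>r. ereal (dens_quotient r0 \<psi> E r))"

definition lower_dens :: "real \<Rightarrow> ereal \<Rightarrow> (real \<Rightarrow> real) \<Rightarrow> real set \<Rightarrow> ereal" where
  "lower_dens r0 R \<psi> E = Liminf (left_end R) (\<lambda>r. ereal (dens_quotient r0 \<psi> E r))"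

end

theory Submission
  imports Defs
begin

text \<open>Monotonicity of \<open>\<phi> \<psi>\<close> gives \<open>\<phi> t \<ge> \<phi> s \<psi> s / \<psi> t\<close> for \<open>s \<le> t\<close>. Hence a value of \<open>\<phi>\<close> near its upper
  limit \<open>K\<close> at \<open>s\<close> keeps \<open>\<phi>\<close> above \<open>K - \<epsilon>\<close> until \<open>\<psi>\<close> has grown by a factor close to \<open>K / (K - \<epsilon>)\<close>,
  and a value near the lower limit \<open>k\<close> at \<open>t\<close> keeps \<open>\<phi>\<close> below \<open>k + \<epsilon>\<close> backwards until \<open>\<psi>\<close> has shrunk
  by a factor close to \<open>(k + \<epsilon>) / k\<close>. An interval \<open>[s, t)\<close> with \<open>\<psi> t = \<theta> \<psi> s\<close> carries the fraction
  \<open>1 - 1 / \<theta>\<close> of \<open>\<psi> t\<close>, so it bounds the upper density of a set containing it from below and the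
  lower density of a set missing it from above. With respect to \<open>exp \<circ> \<psi>\<close> the factor is
  \<open>exp ((\<theta> - 1) \<psi> s)\<close>, which tends to infinity.\<close>

section \<open>Comparing extended reals through the reals between them\<close>

lemma ereal_le_of_reals:
  fixes x y :: ereal
  assumes "\<And>c. ereal c < x \<Longrightarrow> ereal c \<le> y"
  shows "x \<le> y"
proof (rule ccontr)
  assume "\<not> x \<le> y"
  then obtain c where "y < ereal c" "ereal c < x"
    using ereal_dense2 by (meson not_le)
  then show False using assms[of c] by simp
qed

lemma ereal_ge_of_reals:
  fixes x y :: ereal
  assumes "\<And>c. x < ereal c \<Longrightarrow> y \<le> ereal c"
  shows "y \<le> x"
proof (rule ccontr)
  assume "\<not> y \<le> x"
  then obtain c where "x < ereal c" "ereal c < y"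
    using ereal_dense2 by (meson not_le)
  then show False using assms[of c] by simp
qed

text \<open>Arbitrarily close to \<open>R\<close>, the set \<open>E\<close> contains intervals along which \<open>\<psi>\<close> grows by the
  factor \<open>\<theta>\<close>.\<close>

definition has_stretches :: "real \<Rightarrow> ereal \<Rightarrow> (real \<Rightarrow> real) \<Rightarrow> real \<Rightarrow> real set \<Rightarrow> bool" where
  "has_stretches r0 R \<psi> \<theta> E \<longleftrightarrow> (\<exists>\<^sub>F s in left_end R.
     \<forall>t\<in>einterval (ereal r0) R. s \<le> t \<and> \<psi> t < \<theta> * \<psi> s \<longrightarrow> t \<in> E)"

section \<open>The filter at \<open>R\<close> in terms of points of the interval\<close>

text \<open>Finite and infinite \<open>R\<close> become one case. A threshold can always be raised
  into the interval, so later arguments only meet points where \<open>\<psi>\<close> and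
  \<open>\<phi>\<close> are controlled.\<close>

lemma eventually_left_end:
  assumes "ereal r0 < R"
  shows "eventually P (left_end R) \<longleftrightarrow>
    (\<exists>b\<in>einterval (ereal r0) R. \<forall>t\<in>einterval (ereal r0) R. b < t \<longrightarrow> P t)"
proof -
  obtain c where c: "c \<in> einterval (ereal r0) R"
    using einterval_nonempty[OF assms] by blast
  have "eventually P (left_end R) \<longleftrightarrow> (\<exists>b. ereal b < R \<and> (\<forall>t. b < t \<and> ereal t < R \<longrightarrow> P t))"
  proof (cases R)
    case (real x)
    then have "r0 < x" using assms by simp
    then show ?thesis
      using real by (auto simp: left_end_real eventually_at_left)
  next
    case PInf
    then show ?thesis
      by (auto simp: left_end_infinity eventually_at_top_dense)
  next
    case MInf
    then show ?thesis using assms by simp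
  qed
  also have "\<dots> \<longleftrightarrow> (\<exists>b\<in>einterval (ereal r0) R. \<forall>t\<in>einterval (ereal r0) R. b < t \<longrightarrow> P t)"
  proof
    assume "\<exists>b. ereal b < R \<and> (\<forall>t. b < t \<and> ereal t < R \<longrightarrow> P t)"
    then obtain b where b: "ereal b < R" "\<And>t. b < t \<Longrightarrow> ereal t < R \<Longrightarrow> P t" by blast
    have "max b c \<in> einterval (ereal r0) R"
      using b(1) c by (auto simp: einterval_iff max_def)
    then show "\<exists>b\<in>einterval (ereal r0) R. \<forall>t\<in>einterval (ereal r0) R. b < t \<longrightarrow> P t"
      using b(2) by (intro bexI[of _ "max b c"]) (auto simp: einterval_iff)
  next
    assume "\<exists>b\<in>einterval (ereal r0) R. \<forall>t\<in>einterval (ereal r0) R. b < t \<longrightarrow> P t"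
    then obtain b where b: "b \<in> einterval (ereal r0) R"
      "\<And>t. t \<in> einterval (ereal r0) R \<Longrightarrow> b < t \<Longrightarrow> P t" by blast
    then have "\<forall>t. b < t \<and> ereal t < R \<longrightarrow> P t"
      by (metis einterval_iff less_ereal.simps(1) less_trans)
    then show "\<exists>b. ereal b < R \<and> (\<forall>t. b < t \<and> ereal t < R \<longrightarrow> P t)"
      using b(1) by (auto simp: einterval_iff)
  qed
  finally show ?thesis .
qed

lemma frequently_left_end:
  assumes "ereal r0 < R"
  shows "frequently P (left_end R) \<longleftrightarrow>
    (\<forall>b\<in>einterval (ereal r0) R. \<exists>t\<in>einterval (ereal r0) R. b < t \<and> P t)"
  unfolding frequently_def eventually_left_end[OF assms] by blast

section \<open>Elementary properties of a gauge \<open>\<psi>\<close> and of its exponential\<close>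

locale density_gauge =
  fixes r0 :: real and R :: ereal and \<psi> :: "real \<Rightarrow> real"
  assumes less_R: "ereal r0 < R" and gauge: "\<psi> \<in> class_D r0 R"
begin

abbreviation I :: "real set" where "I \<equiv> einterval (ereal r0) R"

lemma I_Icc:
  assumes "a \<in> I" "b \<in> I"
  shows "{a..b} \<subseteq> I"
proof
  fix t assume "t \<in> {a..b}"
  then have "ereal a \<le> ereal t" "ereal t \<le> ereal b" by auto
  then show "t \<in> I"
    using assms unfolding einterval_iff by (meson less_le_trans le_less_trans)
qed

lemma gauge_pos: "t \<in> I \<Longrightarrow> 0 < \<psi> t"
  using gauge unfolding class_D_def by blast

lemma gauge_less_iff: "s \<in> I \<Longrightarrow> t \<in> I \<Longrightarrow> \<psi> s < \<psi> t \<longleftrightarrow> s < t"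
  using gauge strict_mono_on_less[of I \<psi> s t] unfolding class_D_def by blast

lemma gauge_le_iff: "s \<in> I \<Longrightarrow> t \<in> I \<Longrightarrow> \<psi> s \<le> \<psi> t \<longleftrightarrow> s \<le> t"
  using gauge_less_iff[of t s] by (auto simp: not_less[symmetric])

lemma gauge_deriv:
  assumes "t \<in> I"
  shows "(\<psi> has_real_derivative deriv \<psi> t) (at t)"
proof -
  have "\<psi> differentiable at t within I"
    using gauge assms unfolding class_D_def differentiable_on_def by blast
  then have "\<psi> differentiable at t"
    using at_within_open[OF assms open_einterval] by simp
  then show ?thesis
    by (simp add: DERIV_deriv_iff_real_differentiable)
qed

lemma gauge_deriv_nonneg:
  assumes "t \<in> I"
  shows "0 \<le> deriv \<psi> t"
proof (rule mono_on_imp_deriv_nonneg)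
  show "mono_on I \<psi>" by (simp add: mono_on_def gauge_le_iff)
  show "t \<in> interior I" using assms by (simp add: interior_open)
qed (fact gauge_deriv[OF assms])

text \<open>Makes every result of this locale available for the exponential of \<open>\<psi>\<close>
  as well.\<close>

lemma exp_gauge: "density_gauge r0 R (\<lambda>r. exp (\<psi> r))"
proof -
  have "\<not> bounded ((\<lambda>r. exp (\<psi> r)) ` I)"
  proof
    assume "bounded ((\<lambda>r. exp (\<psi> r)) ` I)"
    then obtain B where B: "\<And>r. r \<in> I \<Longrightarrow> exp (\<psi> r) \<le> B"
      by (auto simp: bounded_iff)
    \<comment> \<open>As \<open>\<psi>\<close> is positive and \<open>exp x \<ge> 1 + x\<close>, a
      bound on the exponential bounds \<open>\<psi>\<close>.\<close>
    have "norm (\<psi> r) \<le> B" if "r \<in> I" for r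
      unfolding real_norm_def
      using gauge_pos[OF that] B[OF that] exp_ge_add_one_self[of "\<psi> r"] by linarith
    then have "bounded (\<psi> ` I)" by (auto simp: bounded_iff)
    then show False using gauge by (simp add: class_D_def)
  qed
  moreover have "(\<lambda>r. exp (\<psi> r)) differentiable at r within I" if "r \<in> I" for r
    using DERIV_fun_exp[OF gauge_deriv[OF that]] unfolding has_field_derivative_def
    by (rule differentiable_at_withinI[OF differentiableI])
  moreover have "strict_mono_on I (\<lambda>r. exp (\<psi> r))"
    by (simp add: strict_mono_on_def gauge_less_iff)
  ultimately show ?thesis
    using less_R by (simp add: density_gauge_def class_D_def differentiable_on_def)
qed

lemma gauge_continuous: "continuous_on I \<psi>"
  using gauge_deriv by (intro continuous_at_imp_continuous_on) (auto intro: DERIV_isCont)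

text \<open>Positive and unbounded means unbounded above; the intermediate value theorem does the
  rest. This locates the ends of stretches.\<close>

lemma gauge_attains:
  assumes "s \<in> I" "\<psi> s \<le> y"
  obtains r where "r \<in> I" "s \<le> r" "\<psi> r = y"
proof -
  have "\<exists>u\<in>I. y < \<psi> u"
  proof (rule ccontr)
    assume "\<not> (\<exists>u\<in>I. y < \<psi> u)"
    then have "norm (\<psi> u) \<le> y" if "u \<in> I" for u
      using that gauge_pos[OF that] by auto
    then have "bounded (\<psi> ` I)" by (auto simp: bounded_iff)
    then show False using gauge by (simp add: class_D_def)
  qed
  then obtain u where u: "u \<in> I" "y < \<psi> u" by blast
  have "s < u" using gauge_less_iff assms u by (smt (verit))
  moreover have "continuous_on {s..u} \<psi>"
    by (rule continuous_on_subset[OF gauge_continuous I_Icc[OF assms(1) u(1)]])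
  ultimately obtain r where "s \<le> r" "r \<le> u" "\<psi> r = y"
    using IVT'[of \<psi> s y u] assms u by auto
  then show thesis using that[of r] I_Icc[OF assms(1) u(1)] by auto
qed

lemma gauge_at_top: "eventually (\<lambda>t. y < \<psi> t) (left_end R)"
proof -
  obtain c where c: "c \<in> I" using einterval_nonempty[OF less_R] by blast
  obtain r where r: "r \<in> I" "\<psi> r = max y (\<psi> c)"
    using gauge_attains[OF c, of "max y (\<psi> c)"] by auto
  have "y < \<psi> t" if "t \<in> I" "r < t" for t
    using gauge_less_iff[of r t] that r by auto
  then show ?thesis unfolding eventually_left_end[OF less_R] using r(1) by blast
qed

lemma I_upto:
  assumes "r \<in> I" "t \<in> {r0<..r}"
  shows "t \<in> I"
proof -
  have "ereal r0 < ereal t" "ereal t \<le> ereal r" using assms(2) by auto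
  then show ?thesis
    using assms(1) unfolding einterval_iff by (meson le_less_trans)
qed

section \<open>Integrals of \<open>deriv \<psi>\<close>\<close>

text \<open>The fundamental theorem for the gauge integral accepts a derivative that may be
  discontinuous; nonnegativity then gives absolute integrability, so the value is also the Lebesgue
  integral.\<close>

lemma gauge_deriv_integral_Ico:
  assumes "s \<in> I" "r \<in> I" "s \<le> r"
  shows "(LINT t:{s..<r}|lebesgue. deriv \<psi> t) = \<psi> r - \<psi> s"
proof -
  have sub: "{s..r} \<subseteq> I" using I_Icc[OF assms(1,2)] .
  have "(deriv \<psi> has_integral \<psi> r - \<psi> s) {s..r}"
  proof (rule fundamental_theorem_of_calculus[OF assms(3)])
    show "(\<psi> has_vector_derivative deriv \<psi> t) (at t within {s..r})" if "t \<in> {s..r}" for t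
    proof -
      have "t \<in> I" using sub that by blast
      from has_field_derivative_at_within[OF gauge_deriv[OF this]] show ?thesis
        unfolding has_real_derivative_iff_has_vector_derivative .
    qed
  qed
  then have hi: "(deriv \<psi> has_integral \<psi> r - \<psi> s) {s..<r}"
    by (rule iffD1[OF has_integral_spike_set_eq, rotated -1])
       (auto intro: negligible_subset[of "{r}"])
  then have "deriv \<psi> absolutely_integrable_on {s..<r}"
  proof (rule nonnegative_absolutely_integrable_1[OF has_integral_integrable])
    show "0 \<le> deriv \<psi> t" if "t \<in> {s..<r}" for t
      using sub that by (intro gauge_deriv_nonneg) auto
  qed
  then show ?thesis
    using set_lebesgue_integral_eq_integral(2) hi integral_unique by metis
qed

text \<open>The exact value is \<open>\<psi> r\<close> minus the right limit of
  \<open>\<psi>\<close> at \<open>r0\<close>, and this limit is nonnegative but may be positive;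
  hence only an inequality.\<close>

lemma gauge_deriv_integral_Ioo:
  assumes "r \<in> I"
  shows "set_integrable lebesgue {r0<..<r} (deriv \<psi>)"
    and "(LINT t:{r0<..<r}|lebesgue. deriv \<psi> t) \<le> \<psi> r"
proof -
  \<comment> \<open>By monotonicity the right limit at \<open>r0\<close> is the infimum
    \<open>c\<close>. Assigning it at \<open>r0\<close> yields a function continuous on
    \<open>{r0..r}\<close> with the same derivative inside, as the fundamental theorem
    requires.\<close>
  define c where "c = Inf (\<psi> ` I)"
  define \<psi>0 where "\<psi>0 = (\<lambda>t. if t \<le> r0 then c else \<psi> t)"
  have bdd: "bdd_below (\<psi> ` I)" using gauge_pos by (auto intro!: bdd_belowI[of _ 0] less_imp_le)
  have ne: "\<psi> ` I \<noteq> {}" using assms by auto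
  have c0: "0 \<le> c" unfolding c_def using ne gauge_pos by (intro cInf_greatest) (auto intro: less_imp_le)
  have c_le: "c \<le> \<psi> t" if "t \<in> I" for t
    unfolding c_def using bdd that by (auto intro: cInf_lower)
  have r: "r0 < r" using assms by (auto simp: einterval_iff)
  have deriv0: "(\<psi>0 has_real_derivative deriv \<psi> t) (at t)" if "t \<in> {r0<..r}" for t
  proof (rule has_field_derivative_transform_within_open[OF gauge_deriv])
    show "t \<in> I" using I_upto[OF assms that] .
    show "open {r0<..}" "t \<in> {r0<..}" using that by auto
  qed (auto simp: \<psi>0_def)
  have "continuous (at t within {r0..r}) \<psi>0" if "t \<in> {r0..r}" for t
  proof (cases "t = r0")
    case False
    then have "isCont \<psi>0 t" using deriv0[of t] that by (auto intro: DERIV_isCont)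
    then show ?thesis by (rule continuous_at_imp_continuous_at_within)
  next
    case True
    show ?thesis unfolding True continuous_within
    proof (rule tendstoI)
      \<comment> \<open>Some \<open>u\<close> nearly attains the infimum, and monotonicity keeps
        \<open>\<psi>\<close> between \<open>c\<close> and \<open>c + e\<close> on all of
        \<open>{r0<..<u}\<close>.\<close>
      fix e :: real assume "0 < e"
      then obtain u where u: "u \<in> I" "\<psi> u < c + e"
        using cInf_lessD[OF ne, of "c + e"] by (auto simp: c_def)
      have "r0 < u" using u by (auto simp: einterval_iff)
      moreover have "dist (\<psi>0 t) (\<psi>0 r0) < e" if t: "r0 < t" "t < u" for t
      proof -
        have "t \<in> I" using I_upto[OF u(1)] t by auto
        then have "\<psi> t < \<psi> u" "c \<le> \<psi> t" using gauge_less_iff u t c_le by auto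
        then show ?thesis using t u by (auto simp: \<psi>0_def dist_real_def)
      qed
      ultimately show "\<forall>\<^sub>F t in at r0 within {r0..r}. dist (\<psi>0 t) (\<psi>0 r0) < e"
        unfolding eventually_at
        by (intro exI[of _ "u - r0"]) (auto simp: dist_real_def)
    qed
  qed
  then have "continuous_on {r0..r} \<psi>0" by (simp add: continuous_on_eq_continuous_within)
  then have "(deriv \<psi> has_integral \<psi>0 r - \<psi>0 r0) {r0..r}"
    using r deriv0
    by (intro fundamental_theorem_of_calculus_interior)
       (auto simp: has_real_derivative_iff_has_vector_derivative[symmetric])
  then have hi: "(deriv \<psi> has_integral \<psi> r - c) {r0<..<r}"
    using r by (simp add: has_integral_Icc_iff_Ioo \<psi>0_def)
  then show int: "set_integrable lebesgue {r0<..<r} (deriv \<psi>)"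
    using gauge_deriv_nonneg I_upto[OF assms]
    by (intro nonnegative_absolutely_integrable_1) auto
  show "(LINT t:{r0<..<r}|lebesgue. deriv \<psi> t) \<le> \<psi> r"
    using set_lebesgue_integral_eq_integral(2)[OF int] integral_unique[OF hi] c0 by simp
qed

text \<open>A non-integrable function has integral 0 by convention, so monotonicity in the set rests
  on integrability; both sets inherit it from \<open>{r0<..<r}\<close>.\<close>

lemma gauge_deriv_integral_mono:
  assumes "r \<in> I" "A \<in> sets lebesgue" "B \<in> sets lebesgue" "A \<subseteq> B" "B \<subseteq> {r0<..<r}"
  shows "(LINT t:A|lebesgue. deriv \<psi> t) \<le> (LINT t:B|lebesgue. deriv \<psi> t)"
proof -
  have "set_integrable lebesgue A (deriv \<psi>)" "set_integrable lebesgue B (deriv \<psi>)"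
    using set_integrable_subset[OF gauge_deriv_integral_Ioo(1)[OF assms(1)]] assms by auto
  moreover have "indicator A t *\<^sub>R deriv \<psi> t \<le> indicator B t *\<^sub>R deriv \<psi> t" for t
    using assms(4,5) gauge_deriv_nonneg[OF I_upto[OF assms(1), of t]]
    by (auto simp: indicator_def)
  ultimately show ?thesis
    unfolding set_lebesgue_integral_def set_integrable_def by (intro integral_mono) auto
qed

section \<open>Bounds for the density quotient at a single point\<close>

lemma I_Int_below: "E \<subseteq> I \<Longrightarrow> E \<inter> {r0..<r} = E \<inter> {r0<..<r}"
  by (force simp: einterval_iff)

lemma dens_quotient_nonneg:
  assumes "E \<subseteq> I" "r \<in> I"
  shows "0 \<le> dens_quotient r0 \<psi> E r"
proof -
  have "0 \<le> (LINT t:E \<inter> {r0..<r}|lebesgue. deriv \<psi> t)"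
    unfolding set_lebesgue_integral_def
    using assms(1) gauge_deriv_nonneg by (intro Bochner_Integration.integral_nonneg) (auto simp: indicator_def)
  then show ?thesis using gauge_pos[OF assms(2)] by (simp add: dens_quotient_def)
qed

lemma dens_quotient_le_1:
  assumes "E \<in> sets lebesgue" "E \<subseteq> I" "r \<in> I"
  shows "dens_quotient r0 \<psi> E r \<le> 1"
proof -
  have "(LINT t:E \<inter> {r0..<r}|lebesgue. deriv \<psi> t) \<le> (LINT t:{r0<..<r}|lebesgue. deriv \<psi> t)"
    using assms by (intro gauge_deriv_integral_mono[of r]) (auto simp: I_Int_below)
  also have "\<dots> \<le> \<psi> r" by (rule gauge_deriv_integral_Ioo(2)[OF assms(3)])
  finally show ?thesis using gauge_pos[OF assms(3)] by (simp add: dens_quotient_def)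
qed

text \<open>The stretch contributes \<open>\<psi> r - \<psi> s\<close> to the integral, and the rest
  of \<open>E\<close> contributes nothing negative.\<close>

lemma dens_quotient_ge_of_stretch:
  assumes "E \<in> sets lebesgue" "E \<subseteq> I" "s \<in> I" "r \<in> I" "s \<le> r" "{s..<r} \<subseteq> E"
  shows "1 - \<psi> s / \<psi> r \<le> dens_quotient r0 \<psi> E r"
proof -
  have "r0 < s" using assms(3) by (simp add: einterval_iff)
  then have "(LINT t:{s..<r}|lebesgue. deriv \<psi> t) \<le> (LINT t:E \<inter> {r0..<r}|lebesgue. deriv \<psi> t)"
    using assms by (intro gauge_deriv_integral_mono[of r]) (auto simp: I_Int_below)
  then show ?thesis
    using gauge_deriv_integral_Ico[OF assms(3,4,5)] gauge_pos[OF assms(4)]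
    by (simp add: dens_quotient_def le_divide_eq left_diff_distrib)
qed

text \<open>The integral does not grow along the gap, so the quotient at \<open>s\<close>, which is
  at most 1, is merely rescaled by \<open>\<psi> s / \<psi> r\<close>.\<close>

lemma dens_quotient_le_of_gap:
  assumes "E \<in> sets lebesgue" "E \<subseteq> I" "s \<in> I" "r \<in> I" "s \<le> r" "{s..<r} \<inter> E = {}"
  shows "dens_quotient r0 \<psi> E r \<le> \<psi> s / \<psi> r"
proof -
  have "E \<inter> {r0..<r} = E \<inter> {r0..<s}" using assms(5,6) by (auto simp: disjoint_iff not_le[symmetric])
  then have "dens_quotient r0 \<psi> E r = \<psi> s / \<psi> r * dens_quotient r0 \<psi> E s"
    using gauge_pos[OF assms(3)] by (simp add: dens_quotient_def)
  also have "\<dots> \<le> \<psi> s / \<psi> r * 1"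
    using dens_quotient_le_1[OF assms(1,2,3)] gauge_pos[OF assms(3)] gauge_pos[OF assms(4)]
    by (intro mult_left_mono) auto
  finally show ?thesis by simp
qed

section \<open>Bounds for the densities, obtained from stretches\<close>

lemma upper_dens_le_1:
  assumes "E \<in> sets lebesgue" "E \<subseteq> I"
  shows "upper_dens r0 R \<psi> E \<le> 1"
proof -
  have "eventually (\<lambda>r. ereal (dens_quotient r0 \<psi> E r) \<le> 1) (left_end R)"
    using dens_quotient_le_1[OF assms] einterval_nonempty[OF less_R]
    by (auto simp: eventually_left_end[OF less_R])
  then show ?thesis unfolding upper_dens_def by (rule Limsup_bounded)
qed

lemma lower_dens_nonneg:
  assumes "E \<subseteq> I"
  shows "0 \<le> lower_dens r0 R \<psi> E"
proof -
  have "eventually (\<lambda>r. 0 \<le> ereal (dens_quotient r0 \<psi> E r)) (left_end R)"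
    using dens_quotient_nonneg[OF assms] einterval_nonempty[OF less_R]
    by (auto simp: eventually_left_end[OF less_R])
  then show ?thesis unfolding lower_dens_def by (rule Liminf_bounded)
qed

text \<open>Turns the growth condition into an interval: \<open>\<psi>\<close> reaches
  \<open>\<theta> * \<psi> s\<close> at some \<open>r\<close>, and stays below that value before
  \<open>r\<close> by strict monotonicity.\<close>

lemma stretch_end:
  assumes "s \<in> I" "1 < \<theta>" "\<And>t. t \<in> I \<Longrightarrow> s \<le> t \<Longrightarrow> \<psi> t < \<theta> * \<psi> s \<Longrightarrow> t \<in> E"
  obtains r where "r \<in> I" "s \<le> r" "\<psi> r = \<theta> * \<psi> s" "{s..<r} \<subseteq> E"
proof -
  have "\<psi> s \<le> \<theta> * \<psi> s" using assms(2) gauge_pos[OF assms(1)] by simp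
  then obtain r where r: "r \<in> I" "s \<le> r" "\<psi> r = \<theta> * \<psi> s"
    using gauge_attains[OF assms(1)] by blast
  have "t \<in> E" if "t \<in> {s..<r}" for t
  proof -
    have "t \<in> I" using I_Icc[OF assms(1) r(1)] that by auto
    then show ?thesis using assms(3) that gauge_less_iff[of t r] r by auto
  qed
  then show thesis using that r by blast
qed

text \<open>Otherwise the quotient would stay below \<open>1 - 1 / \<theta>\<close> beyond some
  \<open>b\<close>, which the end of a stretch starting beyond \<open>b\<close> contradicts.\<close>

lemma upper_dens_ge_of_stretches:
  assumes "E \<in> sets lebesgue" "E \<subseteq> I" "1 < \<theta>" "has_stretches r0 R \<psi> \<theta> E"
  shows "ereal (1 - 1 / \<theta>) \<le> upper_dens r0 R \<psi> E"
proof (rule ccontr)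
  assume "\<not> ?thesis"
  then have "eventually (\<lambda>r. ereal (dens_quotient r0 \<psi> E r) < ereal (1 - 1 / \<theta>)) (left_end R)"
    unfolding upper_dens_def not_le by (rule Limsup_lessD)
  then obtain b where b: "b \<in> I"
    "\<And>r. r \<in> I \<Longrightarrow> b < r \<Longrightarrow> dens_quotient r0 \<psi> E r < 1 - 1 / \<theta>"
    by (auto simp: eventually_left_end[OF less_R])
  obtain s where s: "s \<in> I" "b < s" "\<And>t. t \<in> I \<Longrightarrow> s \<le> t \<Longrightarrow> \<psi> t < \<theta> * \<psi> s \<Longrightarrow> t \<in> E"
    using assms(4) b(1) unfolding has_stretches_def frequently_left_end[OF less_R] by blast
  obtain r where r: "r \<in> I" "s \<le> r" "\<psi> r = \<theta> * \<psi> s" "{s..<r} \<subseteq> E"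
    using stretch_end[of s \<theta> E, OF s(1) assms(3) s(3)] by blast
  have "1 - \<psi> s / \<psi> r \<le> dens_quotient r0 \<psi> E r"
    by (rule dens_quotient_ge_of_stretch[OF assms(1,2) s(1) r(1,2,4)])
  moreover have "\<psi> s / \<psi> r = 1 / \<theta>" using gauge_pos[OF s(1)] r(3) by simp
  ultimately show False using b(2)[OF r(1)] s(2) r(2) by linarith
qed

lemma lower_dens_le_of_stretches:
  assumes "E \<in> sets lebesgue" "E \<subseteq> I" "1 < \<theta>" "has_stretches r0 R \<psi> \<theta> (- E)"
  shows "lower_dens r0 R \<psi> E \<le> ereal (1 / \<theta>)"
proof (rule ccontr)
  assume "\<not> ?thesis"
  then have "eventually (\<lambda>r. ereal (dens_quotient r0 \<psi> E r) > ereal (1 / \<theta>)) (left_end R)"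
    unfolding lower_dens_def not_le by (rule less_LiminfD)
  then obtain b where b: "b \<in> I"
    "\<And>r. r \<in> I \<Longrightarrow> b < r \<Longrightarrow> 1 / \<theta> < dens_quotient r0 \<psi> E r"
    by (auto simp: eventually_left_end[OF less_R])
  obtain s where s: "s \<in> I" "b < s" "\<And>t. t \<in> I \<Longrightarrow> s \<le> t \<Longrightarrow> \<psi> t < \<theta> * \<psi> s \<Longrightarrow> t \<in> - E"
    using assms(4) b(1) unfolding has_stretches_def frequently_left_end[OF less_R] by blast
  obtain r where r: "r \<in> I" "s \<le> r" "\<psi> r = \<theta> * \<psi> s" "{s..<r} \<subseteq> - E"
    using stretch_end[of s \<theta> "- E", OF s(1) assms(3) s(3)] by blast
  have "{s..<r} \<inter> E = {}" using r(4) by blast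
  then have "dens_quotient r0 \<psi> E r \<le> \<psi> s / \<psi> r"
    by (rule dens_quotient_le_of_gap[OF assms(1,2) s(1) r(1,2)])
  moreover have "\<psi> s / \<psi> r = 1 / \<theta>" using gauge_pos[OF s(1)] r(3) by simp
  ultimately show False using b(2)[OF r(1)] s(2) r(2) by linarith
qed

lemma has_stretches_eventually_mono:
  assumes "has_stretches r0 R \<psi> \<theta> E" "eventually (\<lambda>t. t \<in> E \<longrightarrow> t \<in> E') (left_end R)"
  shows "has_stretches r0 R \<psi> \<theta> E'"
proof -
  obtain c where c: "c \<in> I" "\<And>t. t \<in> I \<Longrightarrow> c < t \<Longrightarrow> t \<in> E \<Longrightarrow> t \<in> E'"
    using assms(2) unfolding eventually_left_end[OF less_R] by blast
  show ?thesis unfolding has_stretches_def frequently_left_end[OF less_R]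
  proof
    fix b assume b: "b \<in> I"
    have "max b c \<in> I" using b c(1) by (simp add: max_def)
    then obtain s where s: "s \<in> I" "max b c < s"
      "\<And>t. t \<in> I \<Longrightarrow> s \<le> t \<Longrightarrow> \<psi> t < \<theta> * \<psi> s \<Longrightarrow> t \<in> E"
      using assms(1) unfolding has_stretches_def frequently_left_end[OF less_R] by blast
    then have "\<forall>t\<in>I. s \<le> t \<and> \<psi> t < \<theta> * \<psi> s \<longrightarrow> t \<in> E'" using c(2) by fastforce
    then show "\<exists>s\<in>I. b < s \<and> (\<forall>t\<in>I. s \<le> t \<and> \<psi> t < \<theta> * \<psi> s \<longrightarrow> t \<in> E')"
      using s(1,2) by auto
  qed
qed

text \<open>An additive increment of \<open>\<psi>\<close> is a multiplicative one of \<open>exp \<circ> \<psi>\<close>, and it is eventually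
  dominated by any multiplicative increment of \<open>\<psi>\<close>.\<close>

lemma has_stretches_exp:
  assumes "1 < \<theta>" "1 < \<theta>'" "has_stretches r0 R \<psi> \<theta> E"
  shows "has_stretches r0 R (\<lambda>r. exp (\<psi> r)) \<theta>' E"
proof -
  \<comment> \<open>Past this threshold \<open>(\<theta> - 1) * \<psi> s\<close> exceeds
    \<open>ln \<theta>'\<close>, the increment of \<open>\<psi>\<close> that multiplies its
    exponential by \<open>\<theta>'\<close>.\<close>
  have key: "t \<in> E" if "ln \<theta>' / (\<theta> - 1) < \<psi> s" "\<forall>t\<in>I. s \<le> t \<and> \<psi> t < \<theta> * \<psi> s \<longrightarrow> t \<in> E"
    and t: "t \<in> I" "s \<le> t" "exp (\<psi> t) < \<theta>' * exp (\<psi> s)" for s t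
  proof -
    have "\<theta>' * exp (\<psi> s) = exp (ln \<theta>' + \<psi> s)" using assms(2) by (simp add: exp_add)
    then have "\<psi> t < ln \<theta>' + \<psi> s" using t(3) by simp
    moreover have "ln \<theta>' < (\<theta> - 1) * \<psi> s" using that(1) assms(1) by (simp add: field_simps)
    ultimately have "\<psi> t < \<theta> * \<psi> s" by (simp add: algebra_simps)
    then show ?thesis using that by blast
  qed
  show ?thesis
    unfolding has_stretches_def
  proof (rule frequently_elim1)
    show "\<exists>\<^sub>F s in left_end R. (\<forall>t\<in>I. s \<le> t \<and> \<psi> t < \<theta> * \<psi> s \<longrightarrow> t \<in> E) \<and> ln \<theta>' / (\<theta> - 1) < \<psi> s"
      using frequently_eventually_frequently[OF assms(3)[unfolded has_stretches_def] gauge_at_top] .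
  qed (use key in blast)
qed

lemma upper_dens_ge:
  assumes "E \<in> sets lebesgue" "E \<subseteq> I" "0 \<le> x" "x < 1"
    and "\<And>\<theta>. 1 < \<theta> \<Longrightarrow> \<theta> * x < 1 \<Longrightarrow> has_stretches r0 R \<psi> \<theta> E"
  shows "ereal (1 - x) \<le> upper_dens r0 R \<psi> E"
proof (rule ereal_le_of_reals)
  fix c assume "ereal c < ereal (1 - x)"
  \<comment> \<open>\<open>y\<close> is the reciprocal of the factor: \<open>y < 1\<close> makes it
    exceed 1, \<open>x < y\<close> makes it admissible, and \<open>y < 1 - c\<close> lifts the bound
    above \<open>c\<close>.\<close>
  then obtain y where y: "x < y" "y < min 1 (1 - c)"
    using dense[of x "min 1 (1 - c)"] assms(4) by auto
  then have \<theta>: "1 < 1 / y" "1 / y * x < 1" using assms(3) by auto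
  have "ereal c \<le> ereal (1 - 1 / (1 / y))" using y by simp
  also have "\<dots> \<le> upper_dens r0 R \<psi> E"
    by (rule upper_dens_ge_of_stretches[OF assms(1,2) \<theta>(1) assms(5)[OF \<theta>]])
  finally show "ereal c \<le> upper_dens r0 R \<psi> E" .
qed

lemma lower_dens_le:
  assumes "E \<in> sets lebesgue" "E \<subseteq> I" "0 \<le> x" "x < 1"
    and "\<And>\<theta>. 1 < \<theta> \<Longrightarrow> \<theta> * x < 1 \<Longrightarrow> has_stretches r0 R \<psi> \<theta> (- E)"
  shows "lower_dens r0 R \<psi> E \<le> ereal x"
proof (rule ereal_ge_of_reals)
  fix c assume "ereal x < ereal c"
  then obtain y where y: "x < y" "y < min 1 c"
    using dense[of x "min 1 c"] assms(4) by auto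
  then have \<theta>: "1 < 1 / y" "1 / y * x < 1" using assms(3) by auto
  have "lower_dens r0 R \<psi> E \<le> ereal (1 / (1 / y))"
    by (rule lower_dens_le_of_stretches[OF assms(1,2) \<theta>(1) assms(5)[OF \<theta>]])
  also have "\<dots> \<le> ereal c" using y by simp
  finally show "lower_dens r0 R \<psi> E \<le> ereal c" .
qed

lemma upper_dens_eq_1:
  assumes "E \<in> sets lebesgue" "E \<subseteq> I" "\<And>\<theta>. 1 < \<theta> \<Longrightarrow> has_stretches r0 R \<psi> \<theta> E"
  shows "upper_dens r0 R \<psi> E = 1"
  using upper_dens_le_1[OF assms(1,2)] upper_dens_ge[OF assms(1,2), of 0] assms(3)
  by (simp add: antisym one_ereal_def)

lemma lower_dens_eq_0:
  assumes "E \<in> sets lebesgue" "E \<subseteq> I" "\<And>\<theta>. 1 < \<theta> \<Longrightarrow> has_stretches r0 R \<psi> \<theta> (- E)"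
  shows "lower_dens r0 R \<psi> E = 0"
  using lower_dens_nonneg[OF assms(2)] lower_dens_le[OF assms(1,2), of 0] assms(3)
  by (simp add: antisym zero_ereal_def)

text \<open>A single factor above 1 for \<open>\<psi>\<close> yields every factor for its
  exponential, which forces the extreme density.\<close>

lemma upper_dens_exp_eq_1:
  assumes "E \<in> sets lebesgue" "E \<subseteq> I" "1 < \<theta>" "has_stretches r0 R \<psi> \<theta> E"
  shows "upper_dens r0 R (\<lambda>r. exp (\<psi> r)) E = 1"
  using density_gauge.upper_dens_eq_1[OF exp_gauge assms(1,2)] has_stretches_exp[OF assms(3) _ assms(4)]
  by blast

lemma lower_dens_exp_eq_0:
  assumes "E \<in> sets lebesgue" "E \<subseteq> I" "1 < \<theta>" "has_stretches r0 R \<psi> \<theta> (- E)"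
  shows "lower_dens r0 R (\<lambda>r. exp (\<psi> r)) E = 0"
  using density_gauge.lower_dens_eq_0[OF exp_gauge assms(1,2)] has_stretches_exp[OF assms(3) _ assms(4)]
  by blast

end

section \<open>Measurability of \<open>\<phi>\<close>, and stretches of its level sets\<close>

locale gauged_function = density_gauge +
  fixes \<phi> :: "real \<Rightarrow> real"
  assumes mono: "mono_on I (\<lambda>r. \<phi> r * \<psi> r)"
begin

text \<open>\<open>\<phi>\<close> is a monotone function divided by a continuous positive
  one.\<close>

lemma measurable: "\<phi> \<in> borel_measurable (restrict_space borel I)"
proof -
  have "(\<lambda>r. \<phi> r * \<psi> r) \<in> borel_measurable (restrict_space borel I)"
    by (rule borel_measurable_mono_on_fnc[OF mono])
  moreover have "\<psi> \<in> borel_measurable (restrict_space borel I)"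
    by (rule borel_measurable_continuous_on_restrict[OF gauge_continuous])
  ultimately have "(\<lambda>r. \<phi> r * \<psi> r / \<psi> r) \<in> borel_measurable (restrict_space borel I)"
    by (rule borel_measurable_divide)
  moreover have "\<phi> r = \<phi> r * \<psi> r / \<psi> r" if "r \<in> space (restrict_space borel I)" for r
    using that gauge_pos[of r] by (simp add: space_restrict_space)
  ultimately show ?thesis by (subst measurable_cong)
qed

lemma vimage_measurable:
  assumes "A \<in> sets borel"
  shows "{r \<in> I. \<phi> r \<in> A} \<in> sets lebesgue"
proof -
  have "\<phi> -` A \<inter> space (restrict_space borel I) \<in> sets (restrict_space borel I)"
    by (rule measurable_sets[OF measurable assms])
  then have "\<phi> -` A \<inter> I \<in> sets borel"
    by (simp add: space_restrict_space sets_restrict_space_iff)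
  then have "\<phi> -` A \<inter> I \<in> sets lebesgue"
    by (simp add: sets_completionI_sets)
  moreover have "\<phi> -` A \<inter> I = {r \<in> I. \<phi> r \<in> A}" by auto
  ultimately show ?thesis by simp
qed

text \<open>Forward propagation: from a start with \<open>\<phi> s > \<theta> * l\<close>, the value
  of \<open>\<phi>\<close> shrinks at most by the factor by which \<open>\<psi>\<close> has
  grown.\<close>

lemma stretches_above:
  assumes "ereal (\<theta> * l) < Limsup (left_end R) (\<lambda>r. ereal (\<phi> r))" "0 \<le> l"
  shows "has_stretches r0 R \<psi> \<theta> {t. l < \<phi> t}"
proof -
  have freq: "frequently (\<lambda>s. \<theta> * l < \<phi> s) (left_end R)"
  proof (rule ccontr)
    assume "\<not> ?thesis"
    then have "eventually (\<lambda>s. ereal (\<phi> s) \<le> ereal (\<theta> * l)) (left_end R)"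
      by (simp add: not_frequently not_less)
    from Limsup_bounded[OF this] assms(1) show False by simp
  qed
  have "\<exists>s\<in>I. b < s \<and> (\<forall>t\<in>I. s \<le> t \<and> \<psi> t < \<theta> * \<psi> s \<longrightarrow> l < \<phi> t)" if b: "b \<in> I" for b
  proof -
    obtain s where s: "s \<in> I" "b < s" "\<theta> * l < \<phi> s"
      using freq b unfolding frequently_left_end[OF less_R] by blast
    have "l < \<phi> t" if t: "t \<in> I" "s \<le> t" "\<psi> t < \<theta> * \<psi> s" for t
    proof -
      have "l * \<psi> t \<le> l * (\<theta> * \<psi> s)" using t(3) assms(2) by (intro mult_left_mono) auto
      also have "\<dots> = \<theta> * l * \<psi> s" by simp
      also have "\<dots> < \<phi> s * \<psi> s" using s(3) gauge_pos[OF s(1)] by (intro mult_strict_right_mono)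
      also have "\<dots> \<le> \<phi> t * \<psi> t" using mono_onD[OF mono s(1) t(1,2)] .
      finally show ?thesis using gauge_pos[OF t(1)] by simp
    qed
    then show ?thesis using s by blast
  qed
  then show ?thesis unfolding has_stretches_def frequently_left_end[OF less_R] by blast
qed

text \<open>Backward propagation: a point \<open>s\<close> with
  \<open>\<phi> s < l / \<theta>\<close> is the right end of the stretch, whose start
  \<open>r\<close> has \<open>\<psi> r = \<psi> s / \<theta>\<close>.\<close>

lemma stretches_below:
  assumes "Liminf (left_end R) (\<lambda>r. ereal (\<phi> r)) < ereal (l / \<theta>)" "0 \<le> l" "1 < \<theta>"
  shows "has_stretches r0 R \<psi> \<theta> {t. \<phi> t < l}"
proof -
  have freq: "frequently (\<lambda>s. \<phi> s < l / \<theta>) (left_end R)"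
  proof (rule ccontr)
    assume "\<not> ?thesis"
    then have "eventually (\<lambda>s. ereal (l / \<theta>) \<le> ereal (\<phi> s)) (left_end R)"
      by (simp add: not_frequently not_less)
    from Liminf_bounded[OF this] assms(1) show False by simp
  qed
  have "\<exists>r\<in>I. b < r \<and> (\<forall>t\<in>I. r \<le> t \<and> \<psi> t < \<theta> * \<psi> r \<longrightarrow> \<phi> t < l)" if b: "b \<in> I" for b
  proof -
    \<comment> \<open>The stretch lies to the left of \<open>s\<close>, so \<open>s\<close> is
      pushed far enough for its start \<open>r\<close> to stay beyond \<open>b\<close>.\<close>
    have "frequently (\<lambda>s. \<phi> s < l / \<theta> \<and> \<theta> * \<psi> b < \<psi> s) (left_end R)"
      using frequently_eventually_frequently[OF freq gauge_at_top] .
    then obtain s where s: "s \<in> I" "\<phi> s < l / \<theta>" "\<theta> * \<psi> b < \<psi> s"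
      using b unfolding frequently_left_end[OF less_R] by blast
    have "\<psi> b < \<psi> s / \<theta>" using s(3) assms(3) by (simp add: field_simps)
    then obtain r where r: "r \<in> I" "b \<le> r" "\<psi> r = \<psi> s / \<theta>"
      using gauge_attains[OF b, of "\<psi> s / \<theta>"] by auto
    have "b < r" using \<open>\<psi> b < \<psi> s / \<theta>\<close> r gauge_less_iff[OF b r(1)] by simp
    moreover have "\<phi> t < l" if t: "t \<in> I" "r \<le> t" "\<psi> t < \<theta> * \<psi> r" for t
    proof -
      have "\<psi> t < \<psi> s" using t(3) r(3) assms(3) by simp
      then have "t \<le> s" using gauge_less_iff[OF t(1) s(1)] by simp
      then have "\<phi> t * \<psi> t \<le> \<phi> s * \<psi> s" using mono_onD[OF mono t(1) s(1)] by simp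
      also have "\<dots> < l / \<theta> * \<psi> s" using s(2) gauge_pos[OF s(1)] by (intro mult_strict_right_mono)
      also have "\<dots> = l * \<psi> r" using r(3) by simp
      also have "\<dots> \<le> l * \<psi> t"
        using gauge_le_iff[OF r(1) t(1)] t(2) assms(2) by (intro mult_left_mono) auto
      finally show ?thesis using gauge_pos[OF t(1)] by simp
    qed
    ultimately show ?thesis using r(1) by blast
  qed
  then show ?thesis
    unfolding has_stretches_def frequently_left_end[OF less_R] by blast
qed

end

section \<open>Density estimates for the sets \<open>F\<close>, \<open>G\<close> and
  \<open>H\<close>\<close>

text \<open>The side conditions reflect real limits: densities are at most 1, so
  \<open>\<epsilon> / K'\<close> must be too, and once \<open>\<epsilon> > K' - k\<close> both
  \<open>F\<close> and \<open>G\<close> contain all points near \<open>R\<close>.\<close>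

theorem theorem3p1:
  fixes r0 :: real and R :: ereal
    and \<phi> \<psi> :: "real \<Rightarrow> real"
    and K :: ereal and k :: real
  assumes "0 < r0" and "ereal r0 < R"
    and "\<forall>r\<in>einterval (ereal r0) R. 0 \<le> \<phi> r"
    and "Limsup (left_end R) (\<lambda>r. ereal (\<phi> r)) = K"
    and "Liminf (left_end R) (\<lambda>r. ereal (\<phi> r)) = ereal k"
    and "0 \<le> k" and "ereal k < K"
    and "\<psi> \<in> class_D r0 R"
    and "mono_on (einterval (ereal r0) R) (\<lambda>r. \<phi> r * \<psi> r)"
  shows
    "(\<forall>K' \<epsilon> :: real. K = ereal K' \<and> 0 < \<epsilon> \<longrightarrow>
       (let F = {r \<in> einterval (ereal r0) R. \<bar>\<phi> r - K'\<bar> < \<epsilon>};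
            G = {r \<in> einterval (ereal r0) R. \<bar>\<phi> r - k\<bar> < \<epsilon>};
            e\<psi> = (\<lambda>r. exp (\<psi> r))
        in (\<epsilon> \<le> K' \<longrightarrow> upper_dens r0 R \<psi> F \<ge> ereal (\<epsilon> / K')) \<and>
           upper_dens r0 R \<psi> G \<ge> ereal (\<epsilon> / (k + \<epsilon>)) \<and>
           (2 * \<epsilon> \<le> K' - k \<or> k = 0 \<and> \<epsilon> < K' \<longrightarrow> lower_dens r0 R \<psi> F \<le> ereal (k / (k + \<epsilon>))) \<and>
           (2 * \<epsilon> \<le> K' - k \<longrightarrow> lower_dens r0 R \<psi> G \<le> ereal ((K' - \<epsilon>) / K')) \<and>
           upper_dens r0 R e\<psi> F = 1 \<and>
           upper_dens r0 R e\<psi> G = 1 \<and>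
           (\<epsilon> < K' - k \<longrightarrow> lower_dens r0 R e\<psi> F = 0 \<and> lower_dens r0 R e\<psi> G = 0)))
     \<and>
     (K = \<infinity> \<longrightarrow>
       (\<forall>\<^sub>F M :: real in at_top.
         let H = {r \<in> einterval (ereal r0) R. \<phi> r > M}
         in upper_dens r0 R \<psi> H = 1 \<and> lower_dens r0 R \<psi> H \<le> ereal (k / M)))"
proof -
  let ?I = "einterval (ereal r0) R"
  interpret gauged_function r0 R \<psi> \<phi>
    using assms(2,8,9) by unfold_locales
  \<comment> \<open>The lower limit \<open>k\<close> is below \<open>l / \<theta>\<close> exactly
    when \<open>\<theta> * k < l\<close>; the last premise passes the stretch on to any set that
    contains the sublevel set near \<open>R\<close>.\<close>
  have below: "has_stretches r0 R \<psi> \<theta> E"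
    if "1 < \<theta>" "\<theta> * k < l" "eventually (\<lambda>t. \<phi> t < l \<longrightarrow> t \<in> E) (left_end R)" for \<theta> l E
  proof (rule has_stretches_eventually_mono)
    show "has_stretches r0 R \<psi> \<theta> {t. \<phi> t < l}"
    proof (rule stretches_below)
      show "Liminf (left_end R) (\<lambda>r. ereal (\<phi> r)) < ereal (l / \<theta>)"
        using that(1,2) assms(5) by (simp add: field_simps)
      have "0 \<le> \<theta> * k" using that(1) assms(6) by simp
      then show "0 \<le> l" using that(2) by simp
    qed (fact that(1))
    show "eventually (\<lambda>t. t \<in> {t. \<phi> t < l} \<longrightarrow> t \<in> E) (left_end R)" using that(3) by simp
  qed
  have above: "has_stretches r0 R \<psi> \<theta> E"
    if "ereal (\<theta> * l) < K" "0 \<le> l" "eventually (\<lambda>t. l < \<phi> t \<longrightarrow> t \<in> E) (left_end R)" for \<theta> l E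
  proof (rule has_stretches_eventually_mono)
    show "has_stretches r0 R \<psi> \<theta> {t. l < \<phi> t}"
      using that(1,2) assms(4) by (intro stretches_above) auto
    show "eventually (\<lambda>t. t \<in> {t. l < \<phi> t} \<longrightarrow> t \<in> E) (left_end R)" using that(3) by simp
  qed
  \<comment> \<open>Supplies the single factor above 1 that the exponential densities require,
    whenever two levels are strictly separated.\<close>
  have dilate: "\<exists>\<theta>>1. \<theta> * x < y" if "0 \<le> x" "x < y" for x y :: real
  proof (cases "x = 0")
    case True
    then show ?thesis using that by (intro exI[of _ 2]) simp
  next
    case False
    then have "1 < y / x" using that by simp
    then obtain \<theta> where "1 < \<theta>" "\<theta> < y / x" using dense by blast
    then show ?thesis using that False by (intro exI[of _ \<theta>]) (simp add: field_simps)
  qed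
  have ev_I: "eventually (\<lambda>t. t \<in> ?I) (left_end R)"
    using einterval_nonempty[OF assms(2)] by (auto simp: eventually_left_end[OF assms(2)])

  show ?thesis
  proof (intro conjI allI impI)
    fix K' \<epsilon> :: real
    assume "K = ereal K' \<and> 0 < \<epsilon>"
    then have K: "K = ereal K'" and \<epsilon>: "0 < \<epsilon>" by auto
    have kK: "k < K'" using assms(7) K by simp
    define F where "F = {r \<in> ?I. \<bar>\<phi> r - K'\<bar> < \<epsilon>}"
    define G where "G = {r \<in> ?I. \<bar>\<phi> r - k\<bar> < \<epsilon>}"
    have sub: "F \<subseteq> ?I" "G \<subseteq> ?I" by (auto simp: F_def G_def)
    have "F = {r \<in> ?I. \<phi> r \<in> {K' - \<epsilon><..<K' + \<epsilon>}}" "G = {r \<in> ?I. \<phi> r \<in> {k - \<epsilon><..<k + \<epsilon>}}"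
      by (auto simp: F_def G_def)
    then have meas: "F \<in> sets lebesgue" "G \<in> sets lebesgue"
      using vimage_measurable[of "{K' - \<epsilon><..<K' + \<epsilon>}"] vimage_measurable[of "{k - \<epsilon><..<k + \<epsilon>}"]
      by simp_all
    have ev_less: "eventually (\<lambda>t. \<phi> t < K' + \<epsilon>) (left_end R)"
      using Limsup_lessD[of "left_end R" "\<lambda>r. ereal (\<phi> r)" "ereal (K' + \<epsilon>)"] assms(4) K \<epsilon> by simp
    have ev_greater: "eventually (\<lambda>t. k - \<epsilon> < \<phi> t) (left_end R)"
      using less_LiminfD[of "ereal (k - \<epsilon>)" "left_end R" "\<lambda>r. ereal (\<phi> r)"] assms(5) \<epsilon> by simp
    \<comment> \<open>Since \<open>K'\<close> is the upper limit,
      \<open>\<phi> < K' + \<epsilon>\<close> near \<open>R\<close>; only the lower edge of the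
      window remains to be checked.\<close>
    have F_ev: "eventually (\<lambda>t. l < \<phi> t \<longrightarrow> t \<in> F) (left_end R)" if "K' - \<epsilon> \<le> l" for l
      using ev_I ev_less by eventually_elim (use that in \<open>auto simp: F_def\<close>)
    have G_ev: "eventually (\<lambda>t. \<phi> t < k + \<epsilon> \<longrightarrow> t \<in> G) (left_end R)"
      using ev_I ev_greater by eventually_elim (auto simp: G_def)
    have F_compl: "eventually (\<lambda>t. \<phi> t < l \<longrightarrow> t \<in> - F) (left_end R)" if "l \<le> K' - \<epsilon>" for l
      using that by (intro always_eventually) (auto simp: F_def)
    have G_compl: "eventually (\<lambda>t. l < \<phi> t \<longrightarrow> t \<in> - G) (left_end R)" if "k + \<epsilon> \<le> l" for l
      using that by (intro always_eventually) (auto simp: G_def)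

    have "ereal (\<epsilon> / K') \<le> upper_dens r0 R \<psi> F" if le: "\<epsilon> \<le> K'"
    proof -
      \<comment> \<open>The level is \<open>K' - \<epsilon>\<close>, nonnegative by
        \<open>\<epsilon> \<le> K'\<close>; the factors allowed are those with
        \<open>\<theta> * (K' - \<epsilon>) < K'\<close>.\<close>
      have "ereal (1 - (K' - \<epsilon>) / K') \<le> upper_dens r0 R \<psi> F"
      proof (rule upper_dens_ge[OF meas(1) sub(1)])
        show "0 \<le> (K' - \<epsilon>) / K'" "(K' - \<epsilon>) / K' < 1" using kK assms(6) le \<epsilon> by auto
        fix \<theta> assume "1 < \<theta>" "\<theta> * ((K' - \<epsilon>) / K') < 1"
        then show "has_stretches r0 R \<psi> \<theta> F"
          using kK assms(6) le by (intro above[OF _ _ F_ev[OF order_refl]]) (auto simp: K field_simps)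
      qed
      moreover have "1 - (K' - \<epsilon>) / K' = \<epsilon> / K'" using kK assms(6) by (simp add: field_simps)
      ultimately show ?thesis by simp
    qed
    moreover have "ereal (\<epsilon> / (k + \<epsilon>)) \<le> upper_dens r0 R \<psi> G"
    proof -
      have "ereal (1 - k / (k + \<epsilon>)) \<le> upper_dens r0 R \<psi> G"
      proof (rule upper_dens_ge[OF meas(2) sub(2)])
        show "0 \<le> k / (k + \<epsilon>)" "k / (k + \<epsilon>) < 1" using assms(6) \<epsilon> by auto
        fix \<theta> assume "1 < \<theta>" "\<theta> * (k / (k + \<epsilon>)) < 1"
        then show "has_stretches r0 R \<psi> \<theta> G"
          using assms(6) \<epsilon> by (intro below[OF _ _ G_ev]) (auto simp: pos_divide_less_eq)
      qed
      moreover have "1 - k / (k + \<epsilon>) = \<epsilon> / (k + \<epsilon>)" using \<epsilon> assms(6) by (simp add: field_simps)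
      ultimately show ?thesis by simp
    qed
    moreover have "lower_dens r0 R \<psi> F \<le> ereal (k / (k + \<epsilon>))"
      if c: "2 * \<epsilon> \<le> K' - k \<or> k = 0 \<and> \<epsilon> < K'"
    proof (rule lower_dens_le[OF meas(1) sub(1)])
      show "0 \<le> k / (k + \<epsilon>)" "k / (k + \<epsilon>) < 1" using assms(6) \<epsilon> by auto
      fix \<theta> assume \<theta>: "1 < \<theta>" "\<theta> * (k / (k + \<epsilon>)) < 1"
      from c show "has_stretches r0 R \<psi> \<theta> (- F)"
      proof
        \<comment> \<open>Then \<open>k + \<epsilon> \<le> K' - \<epsilon>\<close>, so values below
          \<open>k + \<epsilon>\<close> lie outside the window of \<open>F\<close>.\<close>
        assume "2 * \<epsilon> \<le> K' - k"
        then show ?thesis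
          using \<theta> assms(6) \<epsilon> by (intro below[OF _ _ F_compl, of \<theta> "k + \<epsilon>"]) (auto simp: pos_divide_less_eq)
      next
        \<comment> \<open>With \<open>k = 0\<close> every factor is admissible at any positive
          level; \<open>K' - \<epsilon>\<close> is the largest one that \<open>F_compl\<close>
          allows.\<close>
        assume "k = 0 \<and> \<epsilon> < K'"
        then show ?thesis
          using \<theta> by (intro below[OF _ _ F_compl, of \<theta> "K' - \<epsilon>"]) auto
      qed
    qed
    moreover have "lower_dens r0 R \<psi> G \<le> ereal ((K' - \<epsilon>) / K')" if le: "2 * \<epsilon> \<le> K' - k"
    proof (rule lower_dens_le[OF meas(2) sub(2)])
      show "0 \<le> (K' - \<epsilon>) / K'" "(K' - \<epsilon>) / K' < 1" using kK assms(6) le \<epsilon> by auto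
      fix \<theta> assume "1 < \<theta>" "\<theta> * ((K' - \<epsilon>) / K') < 1"
      \<comment> \<open>Values above \<open>K' - \<epsilon>\<close> miss the window of
        \<open>G\<close>, because \<open>k + \<epsilon> \<le> K' - \<epsilon>\<close>.\<close>
      then show "has_stretches r0 R \<psi> \<theta> (- G)"
        using kK assms(6) le \<epsilon> by (intro above[OF _ _ G_compl, of \<theta> "K' - \<epsilon>"]) (auto simp: K field_simps)
    qed
    moreover have "upper_dens r0 R (\<lambda>r. exp (\<psi> r)) F = 1"
    proof -
      \<comment> \<open>Here \<open>\<epsilon>\<close> may exceed \<open>K'\<close>, so the level is
        cut off at 0 to remain nonnegative.\<close>
      obtain \<theta> where "1 < \<theta>" "\<theta> * max 0 (K' - \<epsilon>) < K'"
        using dilate[of "max 0 (K' - \<epsilon>)" K'] kK assms(6) \<epsilon> by auto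
      then show ?thesis
        by (intro upper_dens_exp_eq_1[OF meas(1) sub(1), of \<theta>] above[OF _ _ F_ev, of \<theta> "max 0 (K' - \<epsilon>)"])
           (auto simp: K)
    qed
    moreover have "upper_dens r0 R (\<lambda>r. exp (\<psi> r)) G = 1"
    proof -
      obtain \<theta> where "1 < \<theta>" "\<theta> * k < k + \<epsilon>" using dilate[of k "k + \<epsilon>"] assms(6) \<epsilon> by auto
      then show ?thesis
        by (intro upper_dens_exp_eq_1[OF meas(2) sub(2), of \<theta>] below[OF _ _ G_ev])
    qed
    moreover have "lower_dens r0 R (\<lambda>r. exp (\<psi> r)) F = 0 \<and> lower_dens r0 R (\<lambda>r. exp (\<psi> r)) G = 0"
      if le: "\<epsilon> < K' - k"
    proof
      \<comment> \<open>The assumption separates \<open>k\<close> from the lower edge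
        \<open>K' - \<epsilon>\<close> of the window of \<open>F\<close>, and likewise
        \<open>K'\<close> from the upper edge \<open>k + \<epsilon>\<close> of that of
        \<open>G\<close>.\<close>
      obtain \<theta> where "1 < \<theta>" "\<theta> * k < K' - \<epsilon>" using dilate[of k "K' - \<epsilon>"] assms(6) le by auto
      then show "lower_dens r0 R (\<lambda>r. exp (\<psi> r)) F = 0"
        by (intro lower_dens_exp_eq_0[OF meas(1) sub(1), of \<theta>] below[OF _ _ F_compl[OF order_refl]])
      obtain \<theta> where "1 < \<theta>" "\<theta> * (k + \<epsilon>) < K'"
        using dilate[of "k + \<epsilon>" K'] assms(6) \<epsilon> le by auto
      then show "lower_dens r0 R (\<lambda>r. exp (\<psi> r)) G = 0"
        using assms(6) \<epsilon>
        by (intro lower_dens_exp_eq_0[OF meas(2) sub(2), of \<theta>] above[OF _ _ G_compl[OF order_refl]])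
           (auto simp: K)
    qed
    ultimately show "let F = {r \<in> ?I. \<bar>\<phi> r - K'\<bar> < \<epsilon>};
            G = {r \<in> ?I. \<bar>\<phi> r - k\<bar> < \<epsilon>};
            e\<psi> = (\<lambda>r. exp (\<psi> r))
        in (\<epsilon> \<le> K' \<longrightarrow> upper_dens r0 R \<psi> F \<ge> ereal (\<epsilon> / K')) \<and>
           upper_dens r0 R \<psi> G \<ge> ereal (\<epsilon> / (k + \<epsilon>)) \<and>
           (2 * \<epsilon> \<le> K' - k \<or> k = 0 \<and> \<epsilon> < K' \<longrightarrow> lower_dens r0 R \<psi> F \<le> ereal (k / (k + \<epsilon>))) \<and>
           (2 * \<epsilon> \<le> K' - k \<longrightarrow> lower_dens r0 R \<psi> G \<le> ereal ((K' - \<epsilon>) / K')) \<and>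
           upper_dens r0 R e\<psi> F = 1 \<and>
           upper_dens r0 R e\<psi> G = 1 \<and>
           (\<epsilon> < K' - k \<longrightarrow> lower_dens r0 R e\<psi> F = 0 \<and> lower_dens r0 R e\<psi> G = 0)"
      unfolding Let_def F_def[symmetric] G_def[symmetric] by blast
  next
    assume K: "K = \<infinity>"
    show "\<forall>\<^sub>F M :: real in at_top.
         let H = {r \<in> ?I. \<phi> r > M}
         in upper_dens r0 R \<psi> H = 1 \<and> lower_dens r0 R \<psi> H \<le> ereal (k / M)"
      using eventually_gt_at_top[of k]
    proof eventually_elim
      \<comment> \<open>Any \<open>M > k\<close> is large enough: it is positive and makes
        \<open>k / M < 1\<close>.\<close>
      fix M assume M: "k < M"
      define H where "H = {r \<in> ?I. \<phi> r > M}"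
      have sub: "H \<subseteq> ?I" by (auto simp: H_def)
      have "H = {r \<in> ?I. \<phi> r \<in> {M<..}}" by (auto simp: H_def)
      then have meas: "H \<in> sets lebesgue" using vimage_measurable[of "{M<..}"] by simp
      have "upper_dens r0 R \<psi> H = 1"
      proof (rule upper_dens_eq_1[OF meas sub])
        fix \<theta> :: real
        have "eventually (\<lambda>t. M < \<phi> t \<longrightarrow> t \<in> H) (left_end R)"
          using ev_I by eventually_elim (auto simp: H_def)
        \<comment> \<open>An infinite upper limit exceeds \<open>\<theta> * M\<close> for every
          \<open>\<theta>\<close>, so stretches of all factors occur.\<close>
        then show "has_stretches r0 R \<psi> \<theta> H"
          using M assms(6) by (intro above[of \<theta> M]) (auto simp: K)
      qed
      moreover have "lower_dens r0 R \<psi> H \<le> ereal (k / M)"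
      proof (rule lower_dens_le[OF meas sub])
        show "0 \<le> k / M" "k / M < 1" using M assms(6) by auto
        fix \<theta> assume "1 < \<theta>" "\<theta> * (k / M) < 1"
        moreover have "eventually (\<lambda>t. \<phi> t < M \<longrightarrow> t \<in> - H) (left_end R)"
          by (intro always_eventually) (auto simp: H_def)
        ultimately show "has_stretches r0 R \<psi> \<theta> (- H)"
          using M assms(6) by (intro below[of \<theta> M]) (auto simp: pos_divide_less_eq)
      qed
      ultimately show "let H = {r \<in> ?I. \<phi> r > M}
         in upper_dens r0 R \<psi> H = 1 \<and> lower_dens r0 R \<psi> H \<le> ereal (k / M)"
        by (simp add: H_def Let_def)
    qed
  qed
qed

end
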